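(* Let $x_0=0$, $x_{t+1}=Ax_t+w_t$ with $A\in\mathbb{R}^{n\times n}$ having spectral radius less than $1$ and $w_t\sim\mathcal N(0,I_n)$ i.i.d., and let $X_-=[x_0,\dots,x_{N-1}]$. Assume there is a positive constant $L_{n,N}$ such that $$\sum_{i=0}^{N-1}\sum_{j=1}^n|\langle x_i,e_j\rangle|^2\le L_{n,N}^2\sum_{i=0}^{N-1}\sum_{j=1}^n|\langle w_i,e_j\rangle|^2$$ (for all values of $w_0,\dots,w_{N-1}$). Then: 1. $\sigma_1(X_-)$, viewed as a function of the $n\times N$ Gaussian ensemble $(w_0,\dots,w_{N-1})\in(\mathbb{R}^n)^N$ equipped with the $\ell_2$ metric, is an $L_{n,N}$-Lipschitz map to $\mathbb{R}$. 2. For every $\delta\in(0,1)$, $$P\Big(\big|\sigma_1(X_-)-\mathbb{E}\sigma_1(X_-)\big|\ge\sqrt2\,\delta\,L_{n,N}\Big)\le2e^{-\delta^2}.$$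
   Context: $\sigma_1(\cdot)$ is the largest singular value, $[e_j]_{j=1}^n$ the canonical basis. With $x_0=0$, each $x_i=\sum_{t=1}^iA^{i-t}w_{t-1}$ is a function of the noise. The $\ell_2$ metric on $(\mathbb{R}^n)^N$ is $\big(\sum_{i}\|u_i-v_i\|^2\big)^{1/2}$. *)

theory Defs
  imports "HOL-Probability.Probability"
begin

definition complex_eigenvalue :: "real^'n^'n \<Rightarrow> complex \<Rightarrow> bool" where
  "complex_eigenvalue A z \<longleftrightarrow>
     (\<exists>v :: complex^'n. v \<noteq> 0 \<and> map_matrix complex_of_real A *v v = z *s v)"

definition spectral_radius :: "real^'n^'n \<Rightarrow> real" where
  "spectral_radius A = Max (cmod ` {z. complex_eigenvalue A z})"

(* Asking for both a left and a right singular vector makes 0 a singular value of a rectangular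
   matrix only if its rank is smaller than both dimensions. *)
definition singular_value :: "real^'m^'n \<Rightarrow> real \<Rightarrow> bool" where
  "singular_value X s \<longleftrightarrow> 0 \<le> s \<and>
     (\<exists>(u :: real^'n) (v :: real^'m). norm u = 1 \<and> norm v = 1 \<and>
        X *v v = s *\<^sub>R u \<and> transpose X *v u = s *\<^sub>R v)"

definition sigma_max :: "real^'m^'n \<Rightarrow> real" where
  "sigma_max X = Max {s. singular_value X s}"

definition std_gaussian_density :: "real^'n \<Rightarrow> real" where
  "std_gaussian_density x = exp (- (norm x)\<^sup>2 / 2) / sqrt (2 * pi) ^ CARD('n)"

primrec lti_state :: "real^'n^'n \<Rightarrow> (nat \<Rightarrow> real^'n) \<Rightarrow> nat \<Rightarrow> real^'n" where
  "lti_state A w 0 = 0"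
| "lti_state A w (Suc t) = A *v lti_state A w t + w t"

(* The columns of the n x N data matrix are indexed by a type 'm with N elements; tau labels
   them by the times 0, ..., N-1. *)
definition data_matrix :: "('m \<Rightarrow> nat) \<Rightarrow> real^'n^'n \<Rightarrow> (nat \<Rightarrow> real^'n) \<Rightarrow> real^'m^'n" where
  "data_matrix tau A w = (\<chi> j k. lti_state A w (tau k) $ j)"

(* A point of (R^n)^N read as a noise sequence. If tau is a bijection onto {..<N}, this gives
   w_0, ..., w_(N-1); the values at later times are unspecified, and the states up to time N-1
   do not depend on them. *)
definition noise_seq :: "('m \<Rightarrow> nat) \<Rightarrow> (real^'n)^'m \<Rightarrow> nat \<Rightarrow> real^'n" where
  "noise_seq tau u t = u $ inv tau t"

end

(* The matrix X_- is linear in the noise, and by hypothesis its Frobenius norm is at most L times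
   the norm of the noise. Since sigma_1(X) = max p . X q over unit vectors p, q, a pair of top
   singular vectors gives sigma_1(X_-) a subgradient of norm at most L at every point; this yields
   the Lipschitz bound.

   For delta < 1 the tail bound needs no exponential moments. It is trivial unless
   exp (-delta^2) < 1/2, and for ln 2 <= delta^2 < 1 it follows from Chebyshev's inequality and
   Var f <= (pi^2/8) L^2, as pi^2/8 <= 4 s exp (-s) on [ln 2, 1]. The variance bound comes from the
   Maurey-Pisier rotation argument: for independent Gaussian X, Y, the quarter turn
   X_theta = cos theta X + sin theta Y from X to Y is cut into k small rotations, all with the same
   joint law, and in L^2 each increment of f is at most L h (1 + o(1)) with h = pi/(2k), because
   in X_h - X = sin h Y - (1 - cos h) X the leading term is independent of the subgradient at X. *)

theory Submission
  imports Defs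
begin

section \<open>Lebesgue measure under shears and rotations\<close>

lemma nn_integral_lborel_translate:
  fixes f :: "'a::euclidean_space \<Rightarrow> ennreal"
  assumes [measurable]: "f \<in> borel_measurable borel"
  shows "(\<integral>\<^sup>+x. f (a + x) \<partial>lborel) = (\<integral>\<^sup>+x. f x \<partial>lborel)"
proof -
  have "(\<integral>\<^sup>+x. f x \<partial>lborel) = (\<integral>\<^sup>+x. f x \<partial>distr lborel borel ((+) a))"
    by (simp add: lborel_distr_plus)
  then show ?thesis
    by (simp add: nn_integral_distr)
qed

lemma nn_integral_lborel_uminus:
  fixes f :: "'a::euclidean_space \<Rightarrow> ennreal"
  assumes [measurable]: "f \<in> borel_measurable borel"
  shows "(\<integral>\<^sup>+x. f (- x) \<partial>lborel) = (\<integral>\<^sup>+x. f x \<partial>lborel)"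
proof -
  have "(lborel :: 'a measure) = distr lborel borel uminus"
    using lborel_affine[of "-1" "0::'a"] by (simp add: density_1)
  then have "(\<integral>\<^sup>+x. f x \<partial>lborel) = (\<integral>\<^sup>+x. f x \<partial>distr lborel borel uminus)"
    by simp
  then show ?thesis
    by (simp add: nn_integral_distr)
qed

text \<open>With the second coordinate fixed, the shear is a translation, so Tonelli reduces the
  claim to translation invariance.\<close>

lemma nn_integral_lborel_shear_fst:
  fixes F :: "'a::euclidean_space \<times> 'a \<Rightarrow> ennreal"
  assumes [measurable]: "F \<in> borel_measurable borel"
  shows "(\<integral>\<^sup>+z. F (fst z + t *\<^sub>R snd z, snd z) \<partial>lborel) = (\<integral>\<^sup>+z. F z \<partial>lborel)"
proof -
  have [measurable]: "F \<in> borel_measurable (lborel \<Otimes>\<^sub>M lborel)"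
    by (simp add: lborel_prod)
  have "(\<integral>\<^sup>+z. F (fst z + t *\<^sub>R snd z, snd z) \<partial>lborel)
      = (\<integral>\<^sup>+z. F (fst z + t *\<^sub>R snd z, snd z) \<partial>(lborel \<Otimes>\<^sub>M lborel))"
    by (simp add: lborel_prod)
  also have "\<dots> = (\<integral>\<^sup>+y. \<integral>\<^sup>+x. F (x + t *\<^sub>R y, y) \<partial>lborel \<partial>lborel)"
    by (subst lborel_pair.nn_integral_snd[symmetric]) (simp_all add: split_beta')
  also have "\<dots> = (\<integral>\<^sup>+y. \<integral>\<^sup>+x. F (x, y) \<partial>lborel \<partial>lborel)"
  proof (rule nn_integral_cong)
    fix y :: 'a
    show "(\<integral>\<^sup>+x. F (x + t *\<^sub>R y, y) \<partial>lborel) = (\<integral>\<^sup>+x. F (x, y) \<partial>lborel)"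
      using nn_integral_lborel_translate[of "\<lambda>x. F (x, y)" "t *\<^sub>R y"] by (simp add: add.commute)
  qed
  also have "\<dots> = (\<integral>\<^sup>+z. F z \<partial>(lborel \<Otimes>\<^sub>M lborel))"
    by (subst lborel_pair.nn_integral_snd[symmetric]) (simp_all add: split_beta')
  finally show ?thesis
    by (simp add: lborel_prod)
qed

lemma nn_integral_lborel_shear_snd:
  fixes F :: "'a::euclidean_space \<times> 'a \<Rightarrow> ennreal"
  assumes [measurable]: "F \<in> borel_measurable borel"
  shows "(\<integral>\<^sup>+z. F (fst z, snd z + t *\<^sub>R fst z) \<partial>lborel) = (\<integral>\<^sup>+z. F z \<partial>lborel)"
proof -
  have [measurable]: "F \<in> borel_measurable (lborel \<Otimes>\<^sub>M lborel)"
    by (simp add: lborel_prod)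
  have "(\<integral>\<^sup>+z. F (fst z, snd z + t *\<^sub>R fst z) \<partial>lborel)
      = (\<integral>\<^sup>+z. F (fst z, snd z + t *\<^sub>R fst z) \<partial>(lborel \<Otimes>\<^sub>M lborel))"
    by (simp add: lborel_prod)
  also have "\<dots> = (\<integral>\<^sup>+x. \<integral>\<^sup>+y. F (x, y + t *\<^sub>R x) \<partial>lborel \<partial>lborel)"
    by (subst lborel.nn_integral_fst[symmetric]) simp_all
  also have "\<dots> = (\<integral>\<^sup>+x. \<integral>\<^sup>+y. F (x, y) \<partial>lborel \<partial>lborel)"
  proof (rule nn_integral_cong)
    fix x :: 'a
    show "(\<integral>\<^sup>+y. F (x, y + t *\<^sub>R x) \<partial>lborel) = (\<integral>\<^sup>+y. F (x, y) \<partial>lborel)"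
      using nn_integral_lborel_translate[of "\<lambda>y. F (x, y)" "t *\<^sub>R x"] by (simp add: add.commute)
  qed
  also have "\<dots> = (\<integral>\<^sup>+z. F z \<partial>(lborel \<Otimes>\<^sub>M lborel))"
    by (subst lborel.nn_integral_fst[symmetric]) simp_all
  finally show ?thesis
    by (simp add: lborel_prod)
qed

text \<open>For z = (X, Y) the first component is X_theta and the second its derivative in \<theta>;
  together they form a one-parameter group of isometries.\<close>

definition rot :: "real \<Rightarrow> 'a::real_vector \<times> 'a \<Rightarrow> 'a \<times> 'a" where
  "rot \<theta> z = (cos \<theta> *\<^sub>R fst z + sin \<theta> *\<^sub>R snd z, cos \<theta> *\<^sub>R snd z - sin \<theta> *\<^sub>R fst z)"

lemma rot_measurable [measurable]: "rot \<theta> \<in> borel \<rightarrow>\<^sub>M (borel :: ('a::euclidean_space \<times> 'a) measure)"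
  unfolding rot_def borel_prod[symmetric] by measurable

lemma norm_rot [simp]: "norm (rot \<theta> (z :: 'a::real_inner \<times> 'a)) = norm z"
proof -
  have "(norm (rot \<theta> z))\<^sup>2
      = (cos \<theta> * cos \<theta> + sin \<theta> * sin \<theta>) * (fst z \<bullet> fst z + snd z \<bullet> snd z)"
    unfolding rot_def power2_norm_eq_inner inner_prod_def
    by (simp add: inner_commute algebra_simps del: sin_cos_squared_add3)
  then have "(norm (rot \<theta> z))\<^sup>2 = (norm z)\<^sup>2"
    by (simp add: power2_norm_eq_inner inner_prod_def)
  then show ?thesis by simp
qed

(* A rotation by less than pi is a product of three shears. *)
lemma nn_integral_lborel_rot:
  fixes F :: "'a::euclidean_space \<times> 'a \<Rightarrow> ennreal"
  assumes [measurable]: "F \<in> borel_measurable borel" and \<theta>: "0 \<le> \<theta>" "\<theta> < pi"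
  shows "(\<integral>\<^sup>+z. F (rot \<theta> z) \<partial>lborel) = (\<integral>\<^sup>+z. F z \<partial>lborel)"
proof -
  \<comment> \<open>The product of the three shears has diagonal entries 1 + t s and off-diagonal
    entries 2 t + t^2 s and s. Matching the rotation gives s = - sin \<theta> and then t = tan
    (\<theta> / 2); \<theta> < pi keeps cos (\<theta> / 2) positive.\<close>
  define t s where "t = tan (\<theta> / 2)" and "s = - sin \<theta>"
  define p q where "p = (\<lambda>z :: 'a \<times> 'a. (fst z + t *\<^sub>R snd z, snd z))"
    and "q = (\<lambda>z :: 'a \<times> 'a. (fst z, snd z + s *\<^sub>R fst z))"
  have [measurable]: "p \<in> borel \<rightarrow>\<^sub>M borel" "q \<in> borel \<rightarrow>\<^sub>M borel"
    unfolding p_def q_def borel_prod[symmetric] by measurable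
  have c: "cos (\<theta> / 2) > 0"
    using \<theta> by (intro cos_gt_zero_pi) auto
  have dbl: "sin \<theta> = 2 * sin (\<theta> / 2) * cos (\<theta> / 2)" "cos \<theta> = 2 * (cos (\<theta> / 2))\<^sup>2 - 1"
    using sin_double[of "\<theta> / 2"] cos_double_cos[of "\<theta> / 2"] by auto
  have sc: "sin (\<theta> / 2) * sin (\<theta> / 2) = 1 - cos (\<theta> / 2) * cos (\<theta> / 2)"
    using sin_cos_squared_add3[of "\<theta> / 2"] by linarith
  have 1: "1 + t * s = cos \<theta>"
    using c by (simp add: t_def s_def tan_def dbl field_simps power2_eq_square sc)
  have "t * (1 + cos \<theta>) = sin \<theta>"
    using c unfolding t_def tan_def dbl by (simp add: field_simps power2_eq_square)
  then have 2: "t + t + t * t * s = sin \<theta>"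
    unfolding 1[symmetric] by (simp add: algebra_simps)
  have 3: "rot \<theta> z = p (q (p z))" for z
  proof -
    have "fst (p (q (p z))) = (1 + t * s) *\<^sub>R fst z + (t + t + t * t * s) *\<^sub>R snd z"
      by (simp add: p_def q_def algebra_simps) (simp flip: scaleR_add_left)
    moreover have "snd (p (q (p z))) = (1 + t * s) *\<^sub>R snd z + s *\<^sub>R fst z"
      by (simp add: p_def q_def algebra_simps)
    ultimately show ?thesis
      unfolding 1 2 by (simp add: rot_def prod_eq_iff s_def)
  qed
  have P: "(\<integral>\<^sup>+z. H (p z) \<partial>lborel) = (\<integral>\<^sup>+z. H z \<partial>lborel)" if "H \<in> borel_measurable borel" for H
    using nn_integral_lborel_shear_fst[OF that, of t] by (simp add: p_def)
  have Q: "(\<integral>\<^sup>+z. H (q z) \<partial>lborel) = (\<integral>\<^sup>+z. H z \<partial>lborel)" if "H \<in> borel_measurable borel" for H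
    using nn_integral_lborel_shear_snd[OF that, of s] by (simp add: q_def)
  have "(\<integral>\<^sup>+z. F (rot \<theta> z) \<partial>lborel) = (\<integral>\<^sup>+z. (\<lambda>z. F (p (q z))) (p z) \<partial>lborel)"
    by (simp add: 3)
  also have "\<dots> = (\<integral>\<^sup>+z. F (p (q z)) \<partial>lborel)"
    by (intro P) measurable
  also have "\<dots> = (\<integral>\<^sup>+z. F (p z) \<partial>lborel)"
    by (rule Q[of "\<lambda>z. F (p z)"]) measurable
  finally show ?thesis by (simp add: P)
qed

section \<open>Standard Gaussian measures\<close>

(* The constant c is determined by prob_G. *)
locale std_gaussian =
  fixes G :: "'a::euclidean_space measure" and c :: real
  assumes G_eq: "G = density lborel (\<lambda>x. ennreal (c * exp (- (norm x)\<^sup>2 / 2)))"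
    and c_nonneg: "0 \<le> c"
    and prob_G: "prob_space G"
begin

sublocale prob_space G
  by (rule prob_G)

lemma sets_G [simp, measurable_cong]: "sets G = sets borel"
  by (simp add: G_eq)

lemma space_G [simp]: "space G = UNIV"
  by (simp add: G_eq)

sublocale pair: pair_sigma_finite G G ..

lemma pair_measurable_eq: "borel_measurable (G \<Otimes>\<^sub>M G) = (borel_measurable borel :: ('a \<times> 'a \<Rightarrow> ennreal) set)"
  by (intro measurable_cong_sets) (simp_all add: borel_prod[symmetric] cong: sets_pair_measure_cong)

text \<open>Squared norms of the components add up, so the joint density depends on the pair only
  through its norm. This is the source of rotation invariance.\<close>

lemma pair_density:
  "G \<Otimes>\<^sub>M G = density lborel (\<lambda>z. ennreal (c\<^sup>2 * exp (- (norm z)\<^sup>2 / 2)))"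
proof -
  have "G \<Otimes>\<^sub>M G = density (lborel \<Otimes>\<^sub>M lborel)
    (\<lambda>(x, y). ennreal (c * exp (- (norm x)\<^sup>2 / 2)) * ennreal (c * exp (- (norm y)\<^sup>2 / 2)))"
    unfolding G_eq
    by (rule pair_measure_density)
       (use sigma_finite_measure_axioms in \<open>auto intro: sigma_finite_lborel simp: G_eq\<close>)
  also have "\<dots> = density lborel (\<lambda>z. ennreal (c\<^sup>2 * exp (- (norm z)\<^sup>2 / 2)))"
    unfolding lborel_prod
    by (intro arg_cong2[where f = density] refl ext)
       (auto simp: ennreal_mult[symmetric] c_nonneg norm_Pair exp_add[symmetric] power2_eq_square add_divide_distrib
          diff_divide_distrib)
  finally show ?thesis .
qed

lemma nn_integral_rot:
  assumes [measurable]: "F \<in> borel_measurable borel" and "0 \<le> \<theta>" "\<theta> < pi"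
  shows "(\<integral>\<^sup>+z. F (rot \<theta> z) \<partial>(G \<Otimes>\<^sub>M G)) = (\<integral>\<^sup>+z. F z \<partial>(G \<Otimes>\<^sub>M G))"
proof -
  define p where "p = (\<lambda>z :: 'a \<times> 'a. ennreal (c\<^sup>2 * exp (- (norm z)\<^sup>2 / 2)))"
  have [measurable]: "p \<in> borel_measurable borel"
    unfolding p_def by measurable
  have "(\<integral>\<^sup>+z. p (rot \<theta> z) * F (rot \<theta> z) \<partial>lborel) = (\<integral>\<^sup>+z. p z * F z \<partial>lborel)"
    by (rule nn_integral_lborel_rot[of "\<lambda>z. p z * F z"]) (use assms in simp_all)
  moreover have "p (rot \<theta> z) = p z" for z
    by (simp add: p_def)
  ultimately show ?thesis
    unfolding pair_density p_def[symmetric] by (simp add: nn_integral_density)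
qed

lemma nn_integral_uminus:
  assumes [measurable]: "f \<in> borel_measurable borel"
  shows "(\<integral>\<^sup>+x. f (- x) \<partial>G) = (\<integral>\<^sup>+x. f x \<partial>G)"
  unfolding G_eq
  using nn_integral_lborel_uminus[of "\<lambda>x. ennreal (c * exp (- (norm x)\<^sup>2 / 2)) * f x"]
  by (simp add: nn_integral_density)

(* Completing the square: the integrand is the Gaussian density translated by g. *)
lemma nn_integral_exp_inner:
  "(\<integral>\<^sup>+x. ennreal (exp (g \<bullet> x)) \<partial>G) = ennreal (exp ((norm g)\<^sup>2 / 2))"
proof -
  define p where "p = (\<lambda>x :: 'a. ennreal (c * exp (- (norm x)\<^sup>2 / 2)))"
  have [measurable]: "p \<in> borel_measurable borel"
    unfolding p_def by measurable
  have *: "p x * ennreal (exp (g \<bullet> x)) = ennreal (exp ((norm g)\<^sup>2 / 2)) * p (- g + x)" for x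
    unfolding p_def
    by (simp add: ennreal_mult[symmetric] c_nonneg exp_add[symmetric] power2_norm_eq_inner
        inner_diff_left inner_diff_right inner_commute field_simps flip: exp_add)
  have "(\<integral>\<^sup>+x. p x * ennreal (exp (g \<bullet> x)) \<partial>lborel) = ennreal (exp ((norm g)\<^sup>2 / 2)) * (\<integral>\<^sup>+x. p x \<partial>lborel)"
    unfolding * using nn_integral_lborel_translate[of p "- g"] by (simp add: nn_integral_cmult)
  moreover have "(\<integral>\<^sup>+x. p x \<partial>lborel) = 1"
    using emeasure_space_1 by (simp add: G_eq p_def emeasure_density)
  ultimately show ?thesis
    unfolding G_eq p_def[symmetric] by (simp add: nn_integral_density)
qed

text \<open>The second moment is read off from exponential moments: the bound 2 + s^2 <= exp s + exp
  (- s) at s = sqrt t (g . x) is integrated and divided by t, and t tends to 0 from the right. This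
  avoids differentiating under the integral.\<close>

lemma nn_integral_inner_square_le:
  "(\<integral>\<^sup>+x. ennreal ((g \<bullet> x)\<^sup>2) \<partial>G) \<le> ennreal ((norm g)\<^sup>2)"
proof -
  \<comment> \<open>Chosen so that the exponential moment for \<open>sqrt t *\<^sub>R g\<close> is
    exp (t a).\<close>
  define a where "a = (norm g)\<^sup>2 / 2"
  have bound: "(\<integral>\<^sup>+x. ennreal ((g \<bullet> x)\<^sup>2) \<partial>G) \<le> ennreal (2 * ((exp (t * a) - 1) / t))"
    if t: "t > 0" for t
  proof -
    have e: "2 + s\<^sup>2 \<le> exp s + exp (- s)" for s :: real
    proof -
      have "s\<^sup>2 / 2 + 1 \<le> cosh s"
      proof -
        let ?f = "\<lambda>n. if even n then s ^ n /\<^sub>R fact n else 0"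
        \<comment> \<open>The index set keeps the terms 1 and s^2 / 2 of the cosh series, all of
          whose terms are nonnegative.\<close>
        have "sum ?f {..<3} \<le> suminf ?f"
          by (rule sum_le_suminf[OF sums_summable[OF cosh_converges]]) (auto simp: zero_le_even_power)
        then show ?thesis
          using sums_unique[OF cosh_converges[of s]] by (simp add: eval_nat_numeral)
      qed
      then show ?thesis by (simp add: cosh_def)
    qed
    have "ennreal t * (\<integral>\<^sup>+x. ennreal ((g \<bullet> x)\<^sup>2) \<partial>G) + 2
        = (\<integral>\<^sup>+x. ennreal (2 + t * (g \<bullet> x)\<^sup>2) \<partial>G)"
      using t by (simp add: nn_integral_add nn_integral_cmult ennreal_mult emeasure_space_1[simplified] add.commute)
    also have "\<dots> \<le> (\<integral>\<^sup>+x. ennreal (exp ((sqrt t *\<^sub>R g) \<bullet> x)) + ennreal (exp ((- (sqrt t *\<^sub>R g)) \<bullet> x)) \<partial>G)"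
      using t e[of "sqrt t * (g \<bullet> x)" for x]
      by (intro nn_integral_mono) (auto simp: power_mult_distrib simp flip: ennreal_plus)
    also have "\<dots> = ennreal (2 * exp (t * a))"
      using t by (subst nn_integral_add)
        (simp_all add: nn_integral_exp_inner power_mult_distrib a_def flip: ennreal_plus del: inner_minus_left inner_scaleR_left)
    finally have *: "ennreal t * (\<integral>\<^sup>+x. ennreal ((g \<bullet> x)\<^sup>2) \<partial>G) + 2 \<le> ennreal (2 * exp (t * a))" .
    \<comment> \<open>Subtracting 2 and dividing by t is done in the reals, so finiteness comes
      first.\<close>
    then have fin: "(\<integral>\<^sup>+x. ennreal ((g \<bullet> x)\<^sup>2) \<partial>G) < \<infinity>"
      using t by (auto simp: less_top[symmetric] ennreal_mult_eq_top_iff top_unique)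
    then obtain r where r: "(\<integral>\<^sup>+x. ennreal ((g \<bullet> x)\<^sup>2) \<partial>G) = ennreal r" "r \<ge> 0"
      by (auto simp: less_top_ennreal)
    have "t * r + 2 \<le> 2 * exp (t * a)"
      using * t r by (simp add: ennreal_mult[symmetric] flip: ennreal_plus ennreal_numeral)
    then show ?thesis
      using t r by (simp add: ennreal_leI field_simps)
  qed
  have "((\<lambda>t. (exp (t * a) - 1) / t) \<longlongrightarrow> a) (at_right 0)"
  proof -
    have "((\<lambda>t. exp (t * a)) has_real_derivative a) (at 0)"
      by (auto intro!: derivative_eq_intros)
    then show ?thesis
      by (simp add: has_field_derivative_iff filterlim_at_split)
  qed
  then have "((\<lambda>t. ennreal (2 * ((exp (t * a) - 1) / t))) \<longlongrightarrow> ennreal (2 * a)) (at_right 0)"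
    by (intro tendsto_intros)
  then have "(\<integral>\<^sup>+x. ennreal ((g \<bullet> x)\<^sup>2) \<partial>G) \<le> ennreal (2 * a)"
    by (rule tendsto_lowerbound) (use bound in \<open>auto intro!: eventually_at_rightI[of 0 1]\<close>)
  then show ?thesis by (simp add: a_def)
qed

text \<open>Over an orthonormal basis the squared norm splits into \<open>DIM('a)\<close> squares of
  functionals of norm 1.\<close>

lemma nn_integral_norm_square_le:
  "(\<integral>\<^sup>+x. ennreal ((norm x)\<^sup>2) \<partial>G) \<le> ennreal (real DIM('a))"
proof -
  have "(\<integral>\<^sup>+x. ennreal ((norm x)\<^sup>2) \<partial>G) = (\<integral>\<^sup>+x. (\<Sum>b\<in>Basis. ennreal ((b \<bullet> x)\<^sup>2)) \<partial>G)"
  proof (rule nn_integral_cong)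
    fix x :: 'a
    have "(norm x)\<^sup>2 = (\<Sum>b\<in>Basis. (b \<bullet> x)\<^sup>2)"
      unfolding power2_norm_eq_inner by (subst euclidean_inner) (simp add: power2_eq_square inner_commute)
    then show "ennreal ((norm x)\<^sup>2) = (\<Sum>b\<in>Basis. ennreal ((b \<bullet> x)\<^sup>2))"
      by (simp add: sum_ennreal)
  qed
  also have "\<dots> = (\<Sum>b\<in>Basis. \<integral>\<^sup>+x. ennreal ((b \<bullet> x)\<^sup>2) \<partial>G)"
    by (intro nn_integral_sum) measurable
  also have "\<dots> \<le> (\<Sum>b\<in>(Basis :: 'a set). 1)"
    using nn_integral_inner_square_le by (intro sum_mono) (metis ennreal_1 norm_Basis one_power2)
  finally show ?thesis
    by (simp add: ennreal_of_nat_eq_real_of_nat)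
qed

text \<open>By the symmetry x -> - x, positive and negative parts contribute equally to the second
  moment, hence the factor 1/2. It offsets the later addition of two one-sided bounds in
  \<open>small_rotation\<close>.\<close>

lemma nn_integral_inner_neg_part:
  "(\<integral>\<^sup>+x. ennreal ((max 0 (- (g \<bullet> x)))\<^sup>2) \<partial>G) \<le> ennreal ((norm g)\<^sup>2 / 2)"
proof -
  let ?I = "\<integral>\<^sup>+x. ennreal ((max 0 (- (g \<bullet> x)))\<^sup>2) \<partial>G"
  have "?I + ?I = (\<integral>\<^sup>+x. ennreal ((max 0 (- (g \<bullet> x)))\<^sup>2) \<partial>G) + (\<integral>\<^sup>+x. ennreal ((max 0 (g \<bullet> x))\<^sup>2) \<partial>G)"
    using nn_integral_uminus[of "\<lambda>x. ennreal ((max 0 (g \<bullet> x))\<^sup>2)"] by simp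
  also have "\<dots> = (\<integral>\<^sup>+x. ennreal ((g \<bullet> x)\<^sup>2) \<partial>G)"
    by (subst nn_integral_add[symmetric]) (auto intro!: nn_integral_cong simp: max_def simp flip: ennreal_plus)
  also have "\<dots> \<le> ennreal ((norm g)\<^sup>2)"
    by (rule nn_integral_inner_square_le)
  finally have *: "?I + ?I \<le> ennreal ((norm g)\<^sup>2)" .
  then obtain r where r: "?I = ennreal r" "r \<ge> 0"
    by (cases ?I) (auto simp: top_unique)
  then show ?thesis
    using * by (simp add: ennreal_leI flip: ennreal_plus)
qed

end

section \<open>Variance of functions with bounded subgradients\<close>

lemma fst_rot_0 [simp]: "fst (rot 0 z) = fst z"
  and fst_rot_pi_half [simp]: "fst (rot (pi / 2) z) = snd z"
  by (simp_all add: rot_def)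

lemma rot_add: "rot \<theta> (rot \<eta> z) = rot (\<theta> + \<eta>) z"
  by (simp add: rot_def sin_add cos_add algebra_simps)

lemma one_minus_cos_le: "1 - cos h \<le> h\<^sup>2 / 2" for h :: real
proof -
  have "(sin (h / 2))\<^sup>2 \<le> (h / 2)\<^sup>2"
    using abs_sin_x_le_abs_x[of "h / 2"] by (simp only: abs_le_square_iff)
  then show ?thesis
    using cos_double_sin[of "h / 2"] by (simp add: power_divide)
qed

context std_gaussian
begin

text \<open>Composed with \<open>rot\<close>, the sign change gives the reflection that exchanges X
  and X_h.\<close>

lemma nn_integral_uminus_snd:
  assumes [measurable]: "F \<in> borel_measurable borel"
  shows "(\<integral>\<^sup>+z. F (fst z, - snd z) \<partial>(G \<Otimes>\<^sub>M G)) = (\<integral>\<^sup>+z. F z \<partial>(G \<Otimes>\<^sub>M G))"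
proof -
  have [measurable]: "F \<in> borel_measurable (G \<Otimes>\<^sub>M G)"
    by (simp add: pair_measurable_eq)
  have "(\<integral>\<^sup>+z. F (fst z, - snd z) \<partial>(G \<Otimes>\<^sub>M G)) = (\<integral>\<^sup>+x. \<integral>\<^sup>+y. F (x, - y) \<partial>G \<partial>G)"
    by (subst nn_integral_fst[symmetric]) simp_all
  also have "\<dots> = (\<integral>\<^sup>+x. \<integral>\<^sup>+y. F (x, y) \<partial>G \<partial>G)"
    by (intro nn_integral_cong nn_integral_uminus[of "\<lambda>y. F (x, y)" for x]) measurable
  also have "\<dots> = (\<integral>\<^sup>+z. F z \<partial>(G \<Otimes>\<^sub>M G))"
    by (subst nn_integral_fst[symmetric]) simp_all
  finally show ?thesis .
qed

end

text \<open>Subgradients stand in for gradients, since sigma_1 need not be differentiable. The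
  vector \<open>g\<close> depends on \<open>x\<close> alone, so it stays fixed while an independent
  Gaussian is integrated.\<close>

locale std_gaussian_subgradient = std_gaussian G c for G :: "'a::euclidean_space measure" and c +
  fixes f :: "'a \<Rightarrow> real" and L :: real
  assumes subgradient: "\<And>x. \<exists>g. norm g \<le> L \<and> (\<forall>y. f x + g \<bullet> (y - x) \<le> f y)"
begin

lemma L_nonneg: "0 \<le> L"
  using subgradient norm_ge_zero order_trans by blast

text \<open>The subgradient at x bounds f x - f y from above only; exchanging x and y gives the
  other sign.\<close>

lemma lipschitz: "L-lipschitz_on UNIV f"
proof (rule lipschitz_onI)
  have *: "f x - f y \<le> L * norm (y - x)" for x y
  proof -
    obtain g where g: "norm g \<le> L" "f x + g \<bullet> (y - x) \<le> f y"
      using subgradient by blast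
    have "- (g \<bullet> (y - x)) \<le> norm g * norm (y - x)"
      using Cauchy_Schwarz_ineq2[of g "y - x"] by linarith
    also have "\<dots> \<le> L * norm (y - x)"
      using g by (intro mult_right_mono) auto
    finally show ?thesis using g by linarith
  qed
  show "dist (f x) (f y) \<le> L * dist x y" for x y
    using *[of x y] *[of y x] by (simp add: dist_norm norm_minus_commute abs_le_iff)
qed (rule L_nonneg)

lemma f_measurable [measurable]: "f \<in> borel_measurable borel"
  using lipschitz_on_continuous_on[OF lipschitz] by (rule borel_measurable_continuous_onI)

section \<open>Increments of f along rotations of a Gaussian pair\<close>

lemma fst_rot_measurable [measurable]: "(\<lambda>z. fst (rot \<theta> z)) \<in> borel \<rightarrow>\<^sub>M (borel :: 'a measure)"
  unfolding rot_def borel_prod[symmetric] by measurable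

lemma fst_borel_measurable [measurable]: "fst \<in> borel \<rightarrow>\<^sub>M (borel :: 'a measure)"
  by (intro borel_measurable_continuous_onI continuous_intros)

lemma snd_borel_measurable [measurable]: "snd \<in> borel \<rightarrow>\<^sub>M (borel :: 'a measure)"
  by (intro borel_measurable_continuous_onI continuous_intros)

text \<open>A subgradient g at x gives f x - f X_h <= (1 - cos h) (g . x) - sin h (g . y). It limits
  decreases only, hence the positive part. Integrating over y first leaves g fixed, and
  \<open>nn_integral_inner_neg_part\<close> handles the leading term.\<close>

lemma small_rotation_pos_part:
  assumes h: "0 < h" "h < pi"
  shows "(\<integral>\<^sup>+z. ennreal ((max 0 (f (fst z) - f (fst (rot h z))))\<^sup>2) \<partial>(G \<Otimes>\<^sub>M G))
    \<le> ennreal (L\<^sup>2 * h\<^sup>2 * (1 + h) * (1 + h * DIM('a) / 2) / 2)" (is "?I \<le> _")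
proof -
  define D where "D = (\<lambda>z. ennreal ((max 0 (f (fst z) - f (fst (rot h z))))\<^sup>2))"
  have "D \<in> borel_measurable borel" unfolding D_def by measurable
  then have [measurable]: "D \<in> borel_measurable (G \<Otimes>\<^sub>M G)"
    by (simp only: pair_measurable_eq)
  have inner: "(\<integral>\<^sup>+y. D (x, y) \<partial>G)
      \<le> ennreal ((1 + h) * h\<^sup>2 * (L\<^sup>2 / 2)) + ennreal ((1 + 1 / h) * (h ^ 4 / 4) * L\<^sup>2) * ennreal ((norm x)\<^sup>2)" for x
  proof -
    obtain g where g: "norm g \<le> L" "\<And>y. f x + g \<bullet> (y - x) \<le> f y"
      using subgradient by blast
    have sin0: "0 \<le> sin h" using h by (intro sin_ge_zero) auto
    have sq: "(max 0 (f x - f (cos h *\<^sub>R x + sin h *\<^sub>R y)))\<^sup>2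
        \<le> (1 + h) * h\<^sup>2 * (max 0 (- (g \<bullet> y)))\<^sup>2 + (1 + 1 / h) * (h ^ 4 / 4) * L\<^sup>2 * (norm x)\<^sup>2" for y
    proof -
      \<comment> \<open>\<open>b\<close> dominates the term linear in y through sin h <= h, and
        \<open>a\<close> the second-order term through 1 - cos h <= h^2 / 2.\<close>
      define a b where "a = h\<^sup>2 / 2 * (L * norm x)" and "b = h * max 0 (- (g \<bullet> y))"
      have ab: "0 \<le> a" "0 \<le> b" using h L_nonneg by (auto simp: a_def b_def)
      have "\<bar>g \<bullet> x\<bar> \<le> norm g * norm x"
        by (rule Cauchy_Schwarz_ineq2)
      also have "\<dots> \<le> L * norm x"
        using g(1) by (rule mult_right_mono) simp
      finally have gx: "g \<bullet> x \<le> L * norm x" by linarith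
      have "f x - f (cos h *\<^sub>R x + sin h *\<^sub>R y) \<le> (1 - cos h) * (g \<bullet> x) + sin h * (- (g \<bullet> y))"
        using g(2)[of "cos h *\<^sub>R x + sin h *\<^sub>R y"] by (simp add: inner_add_right inner_diff_right algebra_simps)
      also have "\<dots> \<le> (1 - cos h) * (L * norm x) + sin h * max 0 (- (g \<bullet> y))"
        using gx sin0 by (intro add_mono mult_left_mono) auto
      also have "\<dots> \<le> a + b"
        unfolding a_def b_def using one_minus_cos_le[of h] sin_x_le_x[of h] L_nonneg h
        by (intro add_mono mult_right_mono) auto
      finally have "max 0 (f x - f (cos h *\<^sub>R x + sin h *\<^sub>R y)) \<le> a + b"
        using ab by simp
      then have "(max 0 (f x - f (cos h *\<^sub>R x + sin h *\<^sub>R y)))\<^sup>2 \<le> (a + b)\<^sup>2"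
        by (intro power_mono) auto
      also have "\<dots> \<le> (1 + h) * b\<^sup>2 + (1 + 1 / h) * a\<^sup>2"
      proof -
        \<comment> \<open>Young's inequality 2 a b <= h b^2 + a^2 / h: the leading b^2 gains only
          the factor 1 + h, while a^2 / h is still of order h^3.\<close>
        have "0 \<le> (h * b - a)\<^sup>2 / h" using h by simp
        then show ?thesis using h by (simp add: field_simps power2_eq_square)
      qed
      also have "\<dots> = (1 + h) * h\<^sup>2 * (max 0 (- (g \<bullet> y)))\<^sup>2 + (1 + 1 / h) * (h ^ 4 / 4) * L\<^sup>2 * (norm x)\<^sup>2"
        by (simp add: a_def b_def power_mult_distrib power_divide flip: power_mult)
      finally show ?thesis .
    qed
    have "(\<integral>\<^sup>+y. D (x, y) \<partial>G) \<le> (\<integral>\<^sup>+y. ennreal ((1 + h) * h\<^sup>2) * ennreal ((max 0 (- (g \<bullet> y)))\<^sup>2)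
         + ennreal ((1 + 1 / h) * (h ^ 4 / 4) * L\<^sup>2 * (norm x)\<^sup>2) \<partial>G)"
      using sq h by (intro nn_integral_mono)
        (simp add: D_def rot_def ennreal_leI flip: ennreal_plus ennreal_mult)
    also have "\<dots> = ennreal ((1 + h) * h\<^sup>2) * (\<integral>\<^sup>+y. ennreal ((max 0 (- (g \<bullet> y)))\<^sup>2) \<partial>G)
         + ennreal ((1 + 1 / h) * (h ^ 4 / 4) * L\<^sup>2 * (norm x)\<^sup>2)"
      using emeasure_space_1 by (simp add: nn_integral_add nn_integral_cmult)
    also have "\<dots> \<le> ennreal ((1 + h) * h\<^sup>2) * ennreal (L\<^sup>2 / 2)
         + ennreal ((1 + 1 / h) * (h ^ 4 / 4) * L\<^sup>2 * (norm x)\<^sup>2)"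
      using g(1) by (intro add_right_mono mult_left_mono order_trans[OF nn_integral_inner_neg_part]
          ennreal_leI divide_right_mono power_mono) simp_all
    also have "ennreal ((1 + h) * h\<^sup>2) * ennreal (L\<^sup>2 / 2) = ennreal ((1 + h) * h\<^sup>2 * (L\<^sup>2 / 2))"
      using h by (intro ennreal_mult[symmetric]) auto
    also have "ennreal ((1 + 1 / h) * (h ^ 4 / 4) * L\<^sup>2 * (norm x)\<^sup>2)
        = ennreal ((1 + 1 / h) * (h ^ 4 / 4) * L\<^sup>2) * ennreal ((norm x)\<^sup>2)"
      using h by (intro ennreal_mult) auto
    finally show ?thesis .
  qed
  have "?I = (\<integral>\<^sup>+x. \<integral>\<^sup>+y. D (x, y) \<partial>G \<partial>G)"
    unfolding D_def[symmetric] by (subst nn_integral_fst[symmetric]) simp_all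
  also have "\<dots> \<le> (\<integral>\<^sup>+x. ennreal ((1 + h) * h\<^sup>2 * (L\<^sup>2 / 2))
      + ennreal ((1 + 1 / h) * (h ^ 4 / 4) * L\<^sup>2) * ennreal ((norm x)\<^sup>2) \<partial>G)"
    by (intro nn_integral_mono inner)
  also have "\<dots> = ennreal ((1 + h) * h\<^sup>2 * (L\<^sup>2 / 2))
      + ennreal ((1 + 1 / h) * (h ^ 4 / 4) * L\<^sup>2) * (\<integral>\<^sup>+x. ennreal ((norm x)\<^sup>2) \<partial>G)"
    using emeasure_space_1 by (simp add: nn_integral_add nn_integral_cmult)
  also have "\<dots> \<le> ennreal ((1 + h) * h\<^sup>2 * (L\<^sup>2 / 2))
      + ennreal ((1 + 1 / h) * (h ^ 4 / 4) * L\<^sup>2) * ennreal (real DIM('a))"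
    by (intro add_mono mult_left_mono nn_integral_norm_square_le) auto
  also have "\<dots> = ennreal ((1 + h) * h\<^sup>2 * (L\<^sup>2 / 2) + (1 + 1 / h) * (h ^ 4 / 4) * L\<^sup>2 * real DIM('a))"
    using h by (simp flip: ennreal_plus ennreal_mult)
  \<comment> \<open>Since (1 + 1 / h) h^4 = h^3 (1 + h), the remainder shares the prefactor of the
    leading term and leaves a correction of h / 2 times the dimension.\<close>
  also have "(1 + h) * h\<^sup>2 * (L\<^sup>2 / 2) + (1 + 1 / h) * (h ^ 4 / 4) * L\<^sup>2 * real DIM('a)
      = L\<^sup>2 * h\<^sup>2 * (1 + h) * (1 + h * DIM('a) / 2) / 2"
    using h by (simp add: field_simps power2_eq_square power4_eq_xxxx)
  finally show ?thesis .
qed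

(* The reflection (X, Y) -> (X_h, sin h X - cos h Y) exchanges X and X_h, so the positive part
   suffices. *)
lemma small_rotation:
  assumes h: "0 < h" "h < pi"
  shows "(\<integral>\<^sup>+z. ennreal ((f (fst z) - f (fst (rot h z)))\<^sup>2) \<partial>(G \<Otimes>\<^sub>M G))
    \<le> ennreal (L\<^sup>2 * h\<^sup>2 * (1 + h) * (1 + h * DIM('a) / 2))"
proof -
  define P where "P = (\<lambda>z. ennreal ((max 0 (f (fst z) - f (fst (rot h z))))\<^sup>2))"
  define Q where "Q = (\<lambda>z. ennreal ((max 0 (f (fst (rot h z)) - f (fst z)))\<^sup>2))"
  have [measurable]: "P \<in> borel_measurable borel" "Q \<in> borel_measurable borel"
    unfolding P_def Q_def by measurable
  have [measurable]: "P \<in> borel_measurable (G \<Otimes>\<^sub>M G)" "Q \<in> borel_measurable (G \<Otimes>\<^sub>M G)"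
    by (simp_all add: pair_measurable_eq)
  have [measurable]: "(\<lambda>z. Q (fst z, - snd z)) \<in> borel_measurable borel"
    unfolding pair_measurable_eq[symmetric] by measurable
  \<comment> \<open>Rotating the reflected point by h returns X: cos h X_h + sin h (sin h X - cos h
    Y) = X.\<close>
  have "(cos h * cos h) *\<^sub>R u + (sin h * sin h) *\<^sub>R u = u" for u :: 'a
    by (simp flip: scaleR_add_left)
  then have swap: "P z = Q (fst (rot h z), - snd (rot h z))" for z
    by (simp add: P_def Q_def rot_def algebra_simps)
  have "(\<integral>\<^sup>+z. Q z \<partial>(G \<Otimes>\<^sub>M G)) = (\<integral>\<^sup>+z. P z \<partial>(G \<Otimes>\<^sub>M G))"
    using nn_integral_uminus_snd[of Q] nn_integral_rot[of "\<lambda>z. Q (fst z, - snd z)" h] h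
    by (simp add: swap)
  moreover have "(\<integral>\<^sup>+z. ennreal ((f (fst z) - f (fst (rot h z)))\<^sup>2) \<partial>(G \<Otimes>\<^sub>M G))
      = (\<integral>\<^sup>+z. P z + Q z \<partial>(G \<Otimes>\<^sub>M G))"
    by (intro nn_integral_cong) (simp add: P_def Q_def max_def power2_commute flip: ennreal_plus)
  moreover have "\<dots> = (\<integral>\<^sup>+z. P z \<partial>(G \<Otimes>\<^sub>M G)) + (\<integral>\<^sup>+z. Q z \<partial>(G \<Otimes>\<^sub>M G))"
    by (rule nn_integral_add) measurable
  ultimately have "(\<integral>\<^sup>+z. ennreal ((f (fst z) - f (fst (rot h z)))\<^sup>2) \<partial>(G \<Otimes>\<^sub>M G))
      = (\<integral>\<^sup>+z. P z \<partial>(G \<Otimes>\<^sub>M G)) + (\<integral>\<^sup>+z. P z \<partial>(G \<Otimes>\<^sub>M G))"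
    by simp
  also have "\<dots> \<le> ennreal (L\<^sup>2 * h\<^sup>2 * (1 + h) * (1 + h * DIM('a) / 2) / 2)
      + ennreal (L\<^sup>2 * h\<^sup>2 * (1 + h) * (1 + h * DIM('a) / 2) / 2)"
    unfolding P_def by (intro add_mono small_rotation_pos_part h)
  also have "\<dots> = ennreal (L\<^sup>2 * h\<^sup>2 * (1 + h) * (1 + h * DIM('a) / 2))"
    using h by (simp flip: ennreal_plus)
  finally show ?thesis .
qed

text \<open>Cauchy-Schwarz bounds the squared telescoping sum by k times the sum of squares, and
  rotation invariance makes the k integrals equal. The resulting factor k^2 h^2 is (pi /
  2)^2.\<close>

lemma quarter_rotation_steps:
  assumes k: "0 < k" and h: "h = pi / (2 * real k)"
  shows "(\<integral>\<^sup>+z. ennreal ((f (fst z) - f (snd z))\<^sup>2) \<partial>(G \<Otimes>\<^sub>M G))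
    \<le> ennreal ((pi / 2)\<^sup>2 * L\<^sup>2 * ((1 + h) * (1 + h * DIM('a) / 2)))"
proof -
  have kh: "real k * h = pi / 2" and h0: "0 < h" and hpi: "h < pi"
    using k pi_gt_zero by (auto simp: h field_simps)
  define D where "D = (\<lambda>z. ennreal ((f (fst z) - f (fst (rot h z)))\<^sup>2))"
  have [measurable]: "D \<in> borel_measurable borel"
    unfolding D_def by measurable
  have [measurable]: "(\<lambda>z. D (rot \<theta> z)) \<in> borel_measurable (G \<Otimes>\<^sub>M G)" for \<theta>
    unfolding pair_measurable_eq by measurable
  have "(f (fst z) - f (snd z))\<^sup>2
      \<le> real k * (\<Sum>i<k. (f (fst (rot (real i * h) z)) - f (fst (rot h (rot (real i * h) z))))\<^sup>2)" for z
  proof -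
    \<comment> \<open>The telescope runs from angle 0, where the first component is X, to k h = pi /
      2, where it is Y.\<close>
    have "f (fst z) - f (snd z)
        = (\<Sum>i<k. f (fst (rot (real i * h) z)) - f (fst (rot (real (Suc i) * h) z)))"
      by (subst sum_lessThan_telescope') (simp add: kh)
    also have "\<dots> = (\<Sum>i<k. f (fst (rot (real i * h) z)) - f (fst (rot h (rot (real i * h) z))))"
      by (simp add: rot_add algebra_simps)
    finally show ?thesis
      using sum_squared_le_sum_of_squares[of
          "\<lambda>i. f (fst (rot (real i * h) z)) - f (fst (rot h (rot (real i * h) z)))" "{..<k}"]
      by (simp add: mult.commute)
  qed
  then have "(\<integral>\<^sup>+z. ennreal ((f (fst z) - f (snd z))\<^sup>2) \<partial>(G \<Otimes>\<^sub>M G))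
      \<le> (\<integral>\<^sup>+z. ennreal (real k) * (\<Sum>i<k. D (rot (real i * h) z)) \<partial>(G \<Otimes>\<^sub>M G))"
    unfolding D_def by (intro nn_integral_mono) (simp add: sum_ennreal sum_nonneg ennreal_leI flip: ennreal_mult)
  also have "\<dots> = ennreal (real k) * (\<Sum>i<k. \<integral>\<^sup>+z. D (rot (real i * h) z) \<partial>(G \<Otimes>\<^sub>M G))"
    by (subst nn_integral_cmult) (measurable, subst nn_integral_sum, auto)
  also have "\<dots> = ennreal (real k) * (\<Sum>i<k. \<integral>\<^sup>+z. D z \<partial>(G \<Otimes>\<^sub>M G))"
  proof (intro arg_cong2[where f = times] refl sum.cong nn_integral_rot)
    fix i assume "i \<in> {..<k}"
    then have "real i * h \<le> real k * h"
      using h0 by (intro mult_right_mono) auto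
    then show "real i * h < pi"
      using kh pi_gt_zero by linarith
  qed (use h0 in auto)
  also have "\<dots> \<le> ennreal (real k) * (\<Sum>i<k. ennreal (L\<^sup>2 * h\<^sup>2 * (1 + h) * (1 + h * DIM('a) / 2)))"
    unfolding D_def by (intro mult_left_mono sum_mono small_rotation h0 hpi) simp
  also have "\<dots> = ennreal ((real k * h)\<^sup>2 * L\<^sup>2 * ((1 + h) * (1 + h * DIM('a) / 2)))"
    using h0 by (simp add: ennreal_of_nat_eq_real_of_nat ennreal_mult'[symmetric] power2_eq_square mult_ac)
  finally show ?thesis unfolding kh .
qed

text \<open>Refining the subdivision removes the dimension from the bound, where it occurs only
  multiplied by h.\<close>

lemma independent_copies:
  "(\<integral>\<^sup>+z. ennreal ((f (fst z) - f (snd z))\<^sup>2) \<partial>(G \<Otimes>\<^sub>M G)) \<le> ennreal ((pi / 2)\<^sup>2 * L\<^sup>2)"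
proof -
  let ?h = "\<lambda>k. pi / (2 * real k)"
  have "(\<lambda>k. inverse (real k) * (pi / 2)) \<longlonglongrightarrow> 0 * (pi / 2)"
    by (intro tendsto_intros lim_inverse_n)
  then have h: "?h \<longlonglongrightarrow> 0"
    by (simp add: field_simps)
  have "isCont (\<lambda>r :: real. (pi / 2)\<^sup>2 * L\<^sup>2 * ((1 + r) * (1 + r * DIM('a) / 2))) 0"
    by (intro continuous_intros) auto
  from isCont_tendsto_compose[OF this h]
  have "(\<lambda>k. ennreal ((pi / 2)\<^sup>2 * L\<^sup>2 * ((1 + ?h k) * (1 + ?h k * DIM('a) / 2))))
      \<longlonglongrightarrow> ennreal ((pi / 2)\<^sup>2 * L\<^sup>2)"
    by (intro tendsto_ennrealI) simp
  then show ?thesis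
    \<comment> \<open>Starting at 1 skips k = 0, where \<open>?h\<close> is only the default 0 of
      division.\<close>
    by (rule LIMSEQ_le_const) (use quarter_rotation_steps in \<open>auto intro!: exI[of _ 1]\<close>)
qed

section \<open>Square integrability and the variance bound\<close>

lemma integrable_square: "integrable G (\<lambda>x. (f x)\<^sup>2)"
proof -
  have "integrable G (\<lambda>x. (norm x)\<^sup>2)"
    using nn_integral_norm_square_le by (intro integrableI_nonneg) (auto intro: le_less_trans)
  then have "integrable G (\<lambda>x. 2 * (f 0)\<^sup>2 + 2 * L\<^sup>2 * (norm x)\<^sup>2)"
    by simp
  then show ?thesis
  proof (rule Bochner_Integration.integrable_bound)
    \<comment> \<open>The Lipschitz bound against the point 0 limits f to linear growth.\<close>
    have "(f x)\<^sup>2 \<le> 2 * (f 0)\<^sup>2 + 2 * L\<^sup>2 * (norm x)\<^sup>2" for x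
    proof -
      have "\<bar>f x - f 0\<bar> \<le> L * norm x"
        using lipschitz_onD[OF lipschitz, of x 0] by (simp add: dist_norm)
      then have "(f x - f 0)\<^sup>2 \<le> (L * norm x)\<^sup>2"
        by (metis abs_ge_zero power2_abs power_mono)
      moreover have "(f x)\<^sup>2 \<le> 2 * (f 0)\<^sup>2 + 2 * (f x - f 0)\<^sup>2"
        using zero_le_power2[of "f x - 2 * f 0"] by (simp add: power2_eq_square algebra_simps)
      ultimately show ?thesis by (simp add: power_mult_distrib)
    qed
    then show "AE x in G. norm ((f x)\<^sup>2) \<le> norm (2 * (f 0)\<^sup>2 + 2 * L\<^sup>2 * (norm x)\<^sup>2)"
      by (simp add: order_trans[OF _ abs_ge_self])
  qed measurable
qed

lemma integrable_f: "integrable G f"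
  by (rule square_integrable_imp_integrable[OF _ integrable_square]) measurable

text \<open>For independent copies E (f X - f Y)^2 = 2 Var f, so the constant is half of (pi /
  2)^2.\<close>

theorem variance_le: "variance f \<le> pi\<^sup>2 / 8 * L\<^sup>2"
proof -
  let ?m = "expectation f" and ?q = "expectation (\<lambda>x. (f x)\<^sup>2)"
  have [measurable]: "(\<lambda>z. ennreal ((f (fst z) - f (snd z))\<^sup>2)) \<in> borel_measurable (G \<Otimes>\<^sub>M G)"
    by measurable
  have fx: "(\<integral>\<^sup>+y. ennreal ((f x - f y)\<^sup>2) \<partial>G) = ennreal ((f x)\<^sup>2 - 2 * f x * ?m + ?q)" for x
  proof (subst nn_integral_eq_integral)
    show "integrable G (\<lambda>y. (f x - f y)\<^sup>2)"
      using integrable_f integrable_square by (simp add: power2_diff)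
    show "ennreal (expectation (\<lambda>y. (f x - f y)\<^sup>2)) = ennreal ((f x)\<^sup>2 - 2 * f x * ?m + ?q)"
      using integrable_f integrable_square prob_space by (simp add: power2_diff algebra_simps)
  qed simp
  have "integrable G (\<lambda>x. (f x)\<^sup>2 - 2 * f x * ?m + ?q)"
    using integrable_f integrable_square by (simp add: mult.assoc)
  \<comment> \<open>The expression is (f x - \<open>?m\<close>)^2 + Var f; as it is nonnegative, its
    extended integral agrees with the ordinary one.\<close>
  moreover have "0 \<le> (f x)\<^sup>2 - 2 * f x * ?m + ?q" for x
  proof -
    have "0 \<le> (f x - ?m)\<^sup>2 + variance f" by simp
    then show ?thesis
      using variance_eq[OF integrable_f integrable_square] by (simp add: power2_diff)
  qed
  ultimately have "(\<integral>\<^sup>+x. ennreal ((f x)\<^sup>2 - 2 * f x * ?m + ?q) \<partial>G)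
      = ennreal (expectation (\<lambda>x. (f x)\<^sup>2 - 2 * f x * ?m + ?q))"
    by (intro nn_integral_eq_integral) auto
  also have "expectation (\<lambda>x. (f x)\<^sup>2 - 2 * f x * ?m + ?q) = 2 * variance f"
    using integrable_f integrable_square prob_space
    by (simp add: variance_eq mult.assoc) (simp add: power2_eq_square)
  finally have "(\<integral>\<^sup>+z. ennreal ((f (fst z) - f (snd z))\<^sup>2) \<partial>(G \<Otimes>\<^sub>M G)) = ennreal (2 * variance f)"
    by (subst nn_integral_fst[symmetric]) (simp_all add: fx)
  then have "2 * variance f \<le> (pi / 2)\<^sup>2 * L\<^sup>2"
    using independent_copies by (simp add: ennreal_le_iff)
  then show ?thesis
    by (simp add: power_divide)
qed

end

section \<open>The largest singular value\<close>

lemma inner_transpose_mult: "u \<bullet> (X *v v) = (transpose X *v u) \<bullet> v" for X :: "real^'m^'n"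
  by (simp add: dot_lmul_matrix transpose_matrix_vector)

text \<open>Finiteness gives the \<open>Max\<close> in \<open>sigma_max\<close> its meaning. Right
  singular vectors for distinct singular values are eigenvectors of X^T X for distinct eigenvalues,
  hence orthogonal, and orthogonal nonzero vectors are independent.\<close>

lemma singular_values_finite: "finite {s. singular_value (X :: real^'m^'n) s}"
proof -
  define S where "S = {s. singular_value X s}"
  have "\<forall>s\<in>S. \<exists>v. norm v = 1 \<and> transpose X *v (X *v v) = s\<^sup>2 *\<^sub>R v"
  proof
    fix s assume "s \<in> S"
    then obtain u v where "norm v = 1" and uv: "X *v v = s *\<^sub>R u" "transpose X *v u = s *\<^sub>R v"
      by (auto simp: S_def singular_value_def)
    moreover have "transpose X *v (X *v v) = s\<^sup>2 *\<^sub>R v"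
      by (simp only: uv matrix_vector_mult_scaleR scaleR_scaleR power2_eq_square)
    ultimately show "\<exists>v. norm v = 1 \<and> transpose X *v (X *v v) = s\<^sup>2 *\<^sub>R v"
      by blast
  qed
  then obtain v where v: "\<And>s. s \<in> S \<Longrightarrow> norm (v s) = 1"
    "\<And>s. s \<in> S \<Longrightarrow> transpose X *v (X *v v s) = s\<^sup>2 *\<^sub>R v s"
    by metis
  have orth: "v s \<bullet> v t = 0" if "s \<in> S" "t \<in> S" "s \<noteq> t" for s t
  proof -
    have "s\<^sup>2 * (v s \<bullet> v t) = (X *v v s) \<bullet> (X *v v t)"
      by (simp only: inner_transpose_mult[of "X *v v s"] v(2)[OF that(1)] inner_scaleR_left)
    also have "\<dots> = t\<^sup>2 * (v s \<bullet> v t)"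
      by (simp only: inner_commute[of "X *v v s"] inner_commute[of "v s"]
          inner_transpose_mult[of "X *v v t"] v(2)[OF that(2)] inner_scaleR_left)
    finally have "v s \<bullet> v t = 0 \<or> s\<^sup>2 = t\<^sup>2" by simp
    moreover have "0 \<le> s" "0 \<le> t"
      using that by (auto simp: S_def singular_value_def)
    ultimately show ?thesis using that(3) by auto
  qed
  have "inj_on v S"
  proof (rule inj_onI, rule ccontr)
    fix s t assume st: "s \<in> S" "t \<in> S" "v s = v t" "s \<noteq> t"
    then show False
      using orth[of s t] v(1)[of t] by simp
  qed
  moreover have "finite (v ` S)"
  proof -
    have "pairwise orthogonal (v ` S)" "0 \<notin> v ` S"
      using orth v(1) by (fastforce simp: pairwise_def orthogonal_def)+
    then show ?thesis
      by (intro independent_imp_finite pairwise_orthogonal_independent)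
  qed
  ultimately show ?thesis
    unfolding S_def[symmetric] by (simp add: finite_image_iff)
qed

text \<open>The form p . X q attains its maximum s on the compact product of unit spheres.
  Maximality forces X q = s p and X^T p = s q, so s is a singular value; every singular value is in
  turn a value of the form.\<close>

lemma sigma_max_variational:
  fixes X :: "real^'m^'n"
  obtains p q where "norm p = 1" "norm q = 1" "p \<bullet> (X *v q) = sigma_max X"
    "\<And>p' q'. norm p' = 1 \<Longrightarrow> norm q' = 1 \<Longrightarrow> p' \<bullet> (X *v q') \<le> sigma_max X"
proof -
  let ?K = "sphere (0 :: real^'n) 1 \<times> sphere (0 :: real^'m) 1"
  let ?F = "\<lambda>z. fst z \<bullet> (X *v snd z)"
  have "(axis undefined 1, axis undefined 1) \<in> ?K"
    by simp
  then have ne: "?K \<noteq> {}" by blast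
  have co: "compact ?K"
    by (intro compact_Times compact_sphere)
  have "continuous_on ?K (\<lambda>z. X *v snd z)"
    by (rule linear_continuous_on_compose[OF continuous_on_snd[OF continuous_on_id] matrix_vector_mul_linear])
  then have "continuous_on ?K ?F"
    by (rule continuous_on_inner[OF continuous_on_fst[OF continuous_on_id]])
  from continuous_attains_sup[OF co ne this]
  obtain z where z: "z \<in> ?K" "\<And>y. y \<in> ?K \<Longrightarrow> ?F y \<le> ?F z"
    by blast
  define p q s where "p = fst z" and "q = snd z" and "s = p \<bullet> (X *v q)"
  have p: "norm p = 1" and q: "norm q = 1"
    using z(1) by (auto simp: p_def q_def mem_Times_iff)
  have max: "p' \<bullet> (X *v q') \<le> s" if "norm p' = 1" "norm q' = 1" for p' q'
    using z(2)[of "(p', q')"] that by (simp add: s_def p_def q_def)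
  \<comment> \<open>The form takes the value - s at (- p, q).\<close>
  have "0 \<le> s"
    using max[of "- p" q] p q by (simp add: s_def)
  (* Maximality bounds the norm of y by s, while y has component s along the unit vector e. *)
  have aligned: "y = s *\<^sub>R e" if e: "norm e = 1" "e \<bullet> y = s" and le: "\<And>e'. norm e' = 1 \<Longrightarrow> e' \<bullet> y \<le> s"
    for e y :: "'b::real_inner"
  proof -
    have "norm y \<le> s"
    proof (cases "y = 0")
      case False
      then show ?thesis
        using le[of "y /\<^sub>R norm y"] by (simp add: dot_square_norm power2_eq_square flip: mult.assoc)
    qed (use \<open>0 \<le> s\<close> in simp)
    then have "(norm y)\<^sup>2 \<le> s\<^sup>2"
      by (simp add: power_mono)
    moreover have "(norm (y - s *\<^sub>R e))\<^sup>2 = (norm y)\<^sup>2 - 2 * s * (e \<bullet> y) + s\<^sup>2 * (norm e)\<^sup>2"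
      unfolding power2_norm_eq_inner
      by (simp add: inner_diff_left inner_diff_right inner_commute[of y e] algebra_simps power2_eq_square)
    ultimately have "(norm (y - s *\<^sub>R e))\<^sup>2 \<le> 0"
      by (simp add: e power2_eq_square)
    then show ?thesis by simp
  qed
  have "X *v q = s *\<^sub>R p"
    by (rule aligned[OF p s_def[symmetric] max[OF _ q]])
  moreover have "transpose X *v p = s *\<^sub>R q"
  proof (rule aligned[OF q])
    have *: "e \<bullet> (transpose X *v p) = p \<bullet> (X *v e)" for e
      by (metis inner_commute inner_transpose_mult)
    show "q \<bullet> (transpose X *v p) = s"
      unfolding * s_def ..
    show "e \<bullet> (transpose X *v p) \<le> s" if "norm e = 1" for e
      unfolding * by (rule max[OF p that])
  qed
  ultimately have "singular_value X s"
    unfolding singular_value_def using p q \<open>0 \<le> s\<close> by blast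
  moreover have "t \<le> s" if sv: "singular_value X t" for t
  proof -
    obtain u v where "norm u = 1" "norm v = 1" "X *v v = t *\<^sub>R u"
      using sv unfolding singular_value_def by blast
    then show ?thesis
      using max[of u v] by (simp add: dot_square_norm)
  qed
  ultimately have "sigma_max X = s"
    unfolding sigma_max_def by (intro Max_eqI singular_values_finite) auto
  then show thesis
    using that[OF p q] max by (simp add: s_def)
qed

section \<open>Linearity and Frobenius bound of the data matrix in the noise\<close>

lemma lti_state_add: "lti_state A (\<lambda>t. v t + w t) i = lti_state A v i + lti_state A w i"
  by (induction i) (simp_all add: matrix_vector_right_distrib)

lemma lti_state_scaleR: "lti_state A (\<lambda>t. r *\<^sub>R v t) i = r *\<^sub>R lti_state A v i"
  by (induction i) (simp_all add: matrix_vector_mult_scaleR scaleR_add_right)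

lemma lti_state_cong: "(\<And>t. t < i \<Longrightarrow> v t = w t) \<Longrightarrow> lti_state A v i = lti_state A w i"
  by (induction i) simp_all

lemma linear_data_matrix:
  "linear (\<lambda>u :: (real^'n)^'m. data_matrix tau A (noise_seq tau u))"
proof (rule linearI)
  show "data_matrix tau A (noise_seq tau (u + v))
      = data_matrix tau A (noise_seq tau u) + data_matrix tau A (noise_seq tau v)" for u v :: "(real^'n)^'m"
    using lti_state_add[of A "noise_seq tau u" "noise_seq tau v"]
    by (simp add: data_matrix_def noise_seq_def[abs_def] vec_eq_iff)
  show "data_matrix tau A (noise_seq tau (r *\<^sub>R u)) = r *\<^sub>R data_matrix tau A (noise_seq tau u)"
    for r and u :: "(real^'n)^'m"
    using lti_state_scaleR[of A r "noise_seq tau u"]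
    by (simp add: data_matrix_def noise_seq_def[abs_def] vec_eq_iff)
qed

text \<open>Turns the coordinate sums in the hypothesis on \<open>L\<close> into squared
  norms.\<close>

lemma sum_inner_axis_square: "(\<Sum>j\<in>UNIV. \<bar>x \<bullet> axis j 1\<bar>\<^sup>2) = (norm x)\<^sup>2" for x :: "real^'n"
  unfolding norm_vec_def L2_set_def by (simp add: inner_axis sum_nonneg)

lemma norm_vec_square: "(norm x)\<^sup>2 = (\<Sum>k\<in>UNIV. (norm (x $ k))\<^sup>2)" for x :: "'b::real_normed_vector^'m"
  by (simp add: norm_vec_def L2_set_def sum_nonneg)

text \<open>The norm of the matrix type is the Frobenius norm, computed by rows, whereas the states
  are the columns of the data matrix.\<close>

lemma norm_transpose: "norm (transpose X) = norm X" for X :: "real^'m^'n"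
proof -
  have "(norm (transpose X))\<^sup>2 = (norm X)\<^sup>2"
    unfolding norm_vec_square by (subst sum.swap) (simp add: transpose_def)
  then show ?thesis by simp
qed

lemma norm_data_matrix_le:
  fixes u :: "(real^'n)^'m"
  assumes columns: "bij_betw tau UNIV {..<N}" and "0 \<le> L"
    and L_bound: "\<And>v :: nat \<Rightarrow> real^'n.
      (\<Sum>i<N. \<Sum>j\<in>UNIV. \<bar>lti_state A v i \<bullet> axis j 1\<bar>\<^sup>2)
        \<le> L\<^sup>2 * (\<Sum>i<N. \<Sum>j\<in>UNIV. \<bar>v i \<bullet> axis j 1\<bar>\<^sup>2)"
  shows "norm (data_matrix tau A (noise_seq tau u)) \<le> L * norm u"
proof -
  let ?v = "noise_seq tau u"
  have "(norm (data_matrix tau A ?v))\<^sup>2 = (norm (transpose (data_matrix tau A ?v)))\<^sup>2"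
    by (simp add: norm_transpose)
  also have "\<dots> = (\<Sum>k\<in>UNIV. (norm (lti_state A ?v (tau k)))\<^sup>2)"
    unfolding norm_vec_square by (simp add: transpose_def data_matrix_def)
  also have "\<dots> = (\<Sum>i<N. (norm (lti_state A ?v i))\<^sup>2)"
    by (rule sum.reindex_bij_betw[OF columns])
  also have "\<dots> \<le> L\<^sup>2 * (\<Sum>i<N. (norm (?v i))\<^sup>2)"
    using L_bound[of ?v] by (simp only: sum_inner_axis_square)
  also have "(\<Sum>i<N. (norm (?v i))\<^sup>2) = (\<Sum>k\<in>UNIV. (norm (?v (tau k)))\<^sup>2)"
    by (rule sum.reindex_bij_betw[OF columns, symmetric])
  \<comment> \<open>Injectivity gives \<open>inv tau (tau k) = k\<close>, so the times below N
    recover each block of \<open>u\<close> once.\<close>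
  also have "\<dots> = (norm u)\<^sup>2"
    using bij_betw_imp_inj_on[OF columns] by (simp add: noise_seq_def norm_vec_square[of u])
  finally have "(norm (data_matrix tau A ?v))\<^sup>2 \<le> (L * norm u)\<^sup>2"
    by (simp add: power_mult_distrib)
  then show ?thesis
    by (rule power2_le_imp_le) (simp add: \<open>0 \<le> L\<close>)
qed

text \<open>Cauchy-Schwarz in each row: the operator norm is at most the Frobenius norm.\<close>

lemma norm_matrix_vector_le: "norm (X *v q) \<le> norm X * norm q" for X :: "real^'m^'n"
proof -
  have "(norm (X *v q))\<^sup>2 = (\<Sum>i\<in>UNIV. (X $ i \<bullet> q)\<^sup>2)"
    by (simp add: norm_vec_square matrix_vector_mul_component)
  also have "\<dots> \<le> (\<Sum>i\<in>UNIV. (norm (X $ i))\<^sup>2 * (norm q)\<^sup>2)"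
    unfolding power2_norm_eq_inner by (intro sum_mono Cauchy_Schwarz_ineq)
  also have "\<dots> = (norm X * norm q)\<^sup>2"
    unfolding sum_distrib_right[symmetric] power_mult_distrib by (simp only: norm_vec_square[of X])
  finally show ?thesis
    by (rule power2_le_imp_le) simp
qed

(* The subgradient represents the functional u -> p . X(u) q at a pair (p, q) of top singular
   vectors of X(x). *)
lemma sigma_max_subgradient:
  fixes X :: "'b::euclidean_space \<Rightarrow> real^'m^'n"
  assumes lin: "linear X" and bound: "\<And>u. norm (X u) \<le> L * norm u"
  shows "\<exists>g. norm g \<le> L \<and> (\<forall>y. sigma_max (X x) + g \<bullet> (y - x) \<le> sigma_max (X y))"
proof -
  obtain p q where pq: "norm p = 1" "norm q = 1" "p \<bullet> (X x *v q) = sigma_max (X x)"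
    by (rule sigma_max_variational[of "X x"])
  let ?l = "\<lambda>u. p \<bullet> (X u *v q)"
  have l: "linear ?l"
    by (rule linearI)
       (simp_all add: linear_add[OF lin] linear_scale[OF lin] matrix_vector_mult_add_rdistrib
         inner_add_right scaleR_matrix_vector_assoc[symmetric])
  define g where "g = (\<Sum>b\<in>Basis. ?l b *\<^sub>R b)"
  have g: "g \<bullet> u = ?l u" for u
  proof -
    have "?l u = (\<Sum>b\<in>Basis. (u \<bullet> b) * ?l b)"
      using linear_sum[OF l, of "\<lambda>b. (u \<bullet> b) *\<^sub>R b" Basis] linear_scale[OF l]
      by (simp add: euclidean_representation)
    then show ?thesis
      by (simp add: g_def inner_sum_left inner_commute[of u] mult.commute)
  qed
  \<comment> \<open>Evaluating the functional at its own representative bounds the norm of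
    \<open>g\<close>.\<close>
  have "norm g * norm g = ?l g"
    using g[of g] by (simp add: dot_square_norm power2_eq_square)
  also have "\<dots> \<le> norm (X g *v q)"
    using norm_cauchy_schwarz[of p "X g *v q"] pq by simp
  also have "\<dots> \<le> L * norm g"
    using norm_matrix_vector_le[of "X g" q] bound[of g] pq by simp
  finally have "norm g * norm g \<le> L * norm g" .
  \<comment> \<open>Covers g = 0, where no factor can be cancelled; any basis vector witnesses
    it.\<close>
  moreover have "0 \<le> L"
    using order_trans[OF norm_ge_zero bound[of "SOME b. b \<in> Basis"]] SOME_Basis by simp
  ultimately have "norm g \<le> L"
    by (cases "g = 0") auto
  moreover have "sigma_max (X x) + g \<bullet> (y - x) \<le> sigma_max (X y)" for y
  proof -
    have "?l y \<le> sigma_max (X y)"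
      by (rule sigma_max_variational[of "X y"]) (use pq in blast)
    then show ?thesis
      using pq by (simp add: g linear_diff[OF l])
  qed
  ultimately show ?thesis by blast
qed

section \<open>The joint law of the noise\<close>

lemma vec_lambda_measurable:
  fixes Y :: "'m::finite \<Rightarrow> 'a \<Rightarrow> 'b::euclidean_space"
  assumes [measurable]: "\<And>k. Y k \<in> borel_measurable M"
  shows "(\<lambda>\<omega>. \<chi> k. Y k \<omega>) \<in> borel_measurable M"
proof (subst borel_measurable_euclidean_space, intro ballI)
  fix b :: "'b^'m" assume "b \<in> Basis"
  then obtain k c where b: "b = axis k c"
    by (auto simp: Basis_vec_def)
  show "(\<lambda>\<omega>. (\<chi> k. Y k \<omega>) \<bullet> b) \<in> borel_measurable M"
    unfolding b inner_axis by simp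
qed

lemma vec_lambda_measurable_PiM [measurable]:
  "vec_lambda \<in> (\<Pi>\<^sub>M k\<in>UNIV. borel) \<rightarrow>\<^sub>M (borel :: ('b::euclidean_space^'m) measure)"
  by (rule vec_lambda_measurable[of "\<lambda>k x. x k"]) measurable

text \<open>Lebesgue measure is determined by its values on boxes, and a box in the vector type is
  the product of the boxes of its blocks.\<close>

lemma distr_PiM_lborel:
  "distr (\<Pi>\<^sub>M k\<in>UNIV. lborel) borel vec_lambda = (lborel :: ('b::euclidean_space^'m) measure)"
proof (rule lborel_eqI[symmetric])
  interpret product_sigma_finite "\<lambda>_ :: 'm. lborel :: 'b measure" ..
  have [measurable]: "vec_lambda \<in> (\<Pi>\<^sub>M k\<in>UNIV. lborel) \<rightarrow>\<^sub>M (borel :: ('b^'m) measure)"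
    using vec_lambda_measurable_PiM by (simp cong: measurable_cong_sets sets_PiM_cong)
  fix l u :: "'b^'m" assume lu: "\<And>b. b \<in> Basis \<Longrightarrow> l \<bullet> b \<le> u \<bullet> b"
  have comp: "l $ k \<bullet> b \<le> u $ k \<bullet> b" if "b \<in> Basis" for k b
    using lu[of "axis k b"] that by (simp add: inner_axis axis_in_Basis_iff)
  have "vec_lambda -` box l u \<inter> space (\<Pi>\<^sub>M k\<in>UNIV. lborel) = (\<Pi>\<^sub>E k\<in>UNIV. box (l $ k) (u $ k))"
    by (auto simp: space_PiM mem_box Basis_vec_def inner_axis PiE_iff)
  then have "emeasure (distr (\<Pi>\<^sub>M k\<in>UNIV. lborel) borel vec_lambda) (box l u)
      = emeasure (\<Pi>\<^sub>M k\<in>UNIV. lborel) (\<Pi>\<^sub>E k\<in>UNIV. box (l $ k) (u $ k))"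
    by (simp add: emeasure_distr)
  also have "\<dots> = (\<Prod>k\<in>UNIV. emeasure lborel (box (l $ k) (u $ k)))"
    by (rule emeasure_PiM) simp_all
  also have "\<dots> = (\<Prod>k\<in>UNIV. ennreal (\<Prod>b\<in>Basis. (u $ k - l $ k) \<bullet> b))"
    using comp by (intro prod.cong refl emeasure_lborel_box) auto
  also have "\<dots> = ennreal (\<Prod>k\<in>UNIV. \<Prod>b\<in>Basis. (u $ k - l $ k) \<bullet> b)"
    using comp by (intro prod_ennreal prod_nonneg) (simp add: inner_diff_left)
  also have "(\<Prod>k\<in>UNIV. \<Prod>b\<in>Basis. (u $ k - l $ k) \<bullet> b) = (\<Prod>b\<in>Basis. (u - l) \<bullet> b)"
  proof -
    have *: "(Basis :: ('b^'m) set) = (\<lambda>(k, b). axis k b) ` (UNIV \<times> Basis)"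
      by (auto simp: Basis_vec_def)
    have "inj_on (\<lambda>(k, b). axis k b :: 'b^'m) (UNIV \<times> Basis)"
      by (auto simp: inj_on_def axis_eq_axis)
    then show ?thesis
      unfolding * by (simp add: prod.reindex prod.cartesian_product split_beta' inner_axis)
  qed
  finally show "emeasure (distr (\<Pi>\<^sub>M k\<in>UNIV. lborel) borel vec_lambda) (box l u)
      = ennreal (\<Prod>b\<in>Basis. (u - l) \<bullet> b)" .
qed simp

text \<open>It suffices to compare both measures on rectangles, where the integral of a product of
  one-variable functions factorizes.\<close>

lemma PiM_density:
  assumes "finite I" and sf: "\<And>i. sigma_finite_measure (M i)"
    and [measurable]: "\<And>i. f i \<in> borel_measurable (M i)"
    and "\<And>i. sigma_finite_measure (density (M i) (f i))"
  shows "(\<Pi>\<^sub>M i\<in>I. density (M i) (f i)) = density (\<Pi>\<^sub>M i\<in>I. M i) (\<lambda>x. \<Prod>i\<in>I. f i (x i))"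
proof -
  interpret M: product_sigma_finite M by (intro product_sigma_finite.intro sf)
  interpret D: product_sigma_finite "\<lambda>i. density (M i) (f i)" by (intro product_sigma_finite.intro assms)
  have meas [measurable]: "(\<lambda>x. \<Prod>i\<in>I. f i (x i)) \<in> borel_measurable (\<Pi>\<^sub>M i\<in>I. M i)"
    by measurable
  show ?thesis
  proof (rule D.PiM_eqI[symmetric, OF \<open>finite I\<close>])
    show "sets (density (\<Pi>\<^sub>M i\<in>I. M i) (\<lambda>x. \<Prod>i\<in>I. f i (x i))) = sets (\<Pi>\<^sub>M i\<in>I. density (M i) (f i))"
      by (simp cong: sets_PiM_cong)
    fix A assume A: "\<And>i. i \<in> I \<Longrightarrow> A i \<in> sets (density (M i) (f i))"
    then have [measurable]: "\<And>i. i \<in> I \<Longrightarrow> A i \<in> sets (M i)" by simp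
    have "emeasure (density (\<Pi>\<^sub>M i\<in>I. M i) (\<lambda>x. \<Prod>i\<in>I. f i (x i))) (\<Pi>\<^sub>E i\<in>I. A i)
        = (\<integral>\<^sup>+x. (\<Prod>i\<in>I. f i (x i)) * indicator (\<Pi>\<^sub>E i\<in>I. A i) x \<partial>(\<Pi>\<^sub>M i\<in>I. M i))"
      using \<open>finite I\<close> by (intro emeasure_density meas sets_PiM_I_finite) simp_all
    also have "\<dots> = (\<integral>\<^sup>+x. (\<Prod>i\<in>I. f i (x i) * indicator (A i) (x i)) \<partial>(\<Pi>\<^sub>M i\<in>I. M i))"
    proof (rule nn_integral_cong)
      fix x assume "x \<in> space (\<Pi>\<^sub>M i\<in>I. M i)"
      \<comment> \<open>Extensionality makes membership in the rectangle a condition on the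
        coordinates in \<open>I\<close> alone.\<close>
      then have "x \<in> extensional I" by (simp add: space_PiM PiE_def)
      then have "indicator (\<Pi>\<^sub>E i\<in>I. A i) x = (\<Prod>i\<in>I. indicator (A i) (x i) :: ennreal)"
        using \<open>finite I\<close> by (auto simp: indicator_def PiE_iff prod_zero_iff)
      then show "(\<Prod>i\<in>I. f i (x i)) * indicator (\<Pi>\<^sub>E i\<in>I. A i) x
          = (\<Prod>i\<in>I. f i (x i) * indicator (A i) (x i))"
        by (simp add: prod.distrib)
    qed
    also have "\<dots> = (\<Prod>i\<in>I. \<integral>\<^sup>+x. f i x * indicator (A i) x \<partial>M i)"
      by (rule M.product_nn_integral_prod[OF \<open>finite I\<close>]) measurable
    also have "\<dots> = (\<Prod>i\<in>I. emeasure (density (M i) (f i)) (A i))"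
      by (intro prod.cong refl) (simp add: emeasure_density)
    finally show "emeasure (density (\<Pi>\<^sub>M i\<in>I. M i) (\<lambda>x. \<Prod>i\<in>I. f i (x i))) (\<Pi>\<^sub>E i\<in>I. A i)
        = (\<Prod>i\<in>I. emeasure (density (M i) (f i)) (A i))" .
  qed
qed

text \<open>Carries independence from the times to the column labels; injectivity prevents one
  variable from occurring under two labels.\<close>

lemma (in prob_space) indep_vars_reindex_inj:
  assumes indep: "indep_vars M' X (f ` I)" and f: "inj_on f I"
  shows "indep_vars (\<lambda>i. M' (f i)) (\<lambda>i. X (f i)) I"
  unfolding indep_vars_def2
proof (intro conjI ballI indep_setsI)
  show "random_variable (M' (f i)) (X (f i))" if "i \<in> I" for i
    using indep that by (simp add: indep_vars_def2)
  let ?F = "\<lambda>j. {X j -` A \<inter> space M |A. A \<in> sets (M' j)}"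
  have ind: "indep_sets ?F (f ` I)"
    using indep by (simp add: indep_vars_def2)
  show "?F (f i) \<subseteq> events" if "i \<in> I" for i
    using ind that by (auto simp: indep_sets_def)
  fix A J assume J: "J \<noteq> {}" "J \<subseteq> I" "finite J" and A: "\<forall>j\<in>J. A j \<in> ?F (f j)"
  define B where "B = (\<lambda>j. A (inv_into J f j))"
  have fJ: "inj_on f J" using f J(2) by (rule inj_on_subset)
  have B: "B (f j) = A j" if "j \<in> J" for j
    using fJ that by (simp add: B_def)
  have "prob (\<Inter>j\<in>f ` J. B j) = (\<Prod>j\<in>f ` J. prob (B j))"
    by (rule indep_setsD[OF ind]) (use J A B in auto)
  then show "prob (\<Inter>j\<in>J. A j) = (\<Prod>j\<in>J. prob (A j))"
    using B by (simp add: prod.reindex[OF fJ])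
qed

text \<open>Independence makes the joint law a product measure, whose density is a product of
  exponentials, so the squared norms of the blocks add up to that of the vector. The law is then
  pushed to the vector type.\<close>

lemma (in prob_space) std_gaussian_vec:
  fixes Y :: "'m::finite \<Rightarrow> 'a \<Rightarrow> 'b::euclidean_space"
  assumes indep: "indep_vars (\<lambda>_. borel) Y UNIV" and "0 \<le> c"
    and gaussian: "\<And>k. distributed M lborel (Y k) (\<lambda>x. ennreal (c * exp (- (norm x)\<^sup>2 / 2)))"
  shows "std_gaussian (distr M borel (\<lambda>\<omega>. \<chi> k. Y k \<omega>)) (c ^ CARD('m))"
proof (rule std_gaussian.intro)
  let ?p = "\<lambda>x :: 'b. ennreal (c * exp (- (norm x)\<^sup>2 / 2))"
  have Y [measurable]: "Y k \<in> borel_measurable M" for k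
    using distributed_measurable[OF gaussian[of k]] by simp
  have law: "distr M borel (Y k) = density lborel ?p" for k
    using distributed_distr_eq_density[OF gaussian[of k]] by (simp cong: distr_cong)
  have sf: "sigma_finite_measure (density lborel ?p)"
    using prob_space_distr[OF Y[of undefined]] unfolding law by (rule prob_space_imp_sigma_finite)
  have vl [measurable]: "vec_lambda \<in> (\<Pi>\<^sub>M k\<in>UNIV. lborel) \<rightarrow>\<^sub>M (borel :: ('b^'m) measure)"
    using vec_lambda_measurable_PiM by (simp cong: measurable_cong_sets sets_PiM_cong)
  have "distr M borel (\<lambda>\<omega>. \<chi> k. Y k \<omega>) = distr (distr M (\<Pi>\<^sub>M k\<in>UNIV. borel) (\<lambda>\<omega>. \<lambda>k\<in>UNIV. Y k \<omega>)) borel vec_lambda"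
    by (subst distr_distr) (measurable, simp add: comp_def restrict_def)
  also have "\<dots> = distr (\<Pi>\<^sub>M k\<in>UNIV. density lborel ?p) borel vec_lambda"
    using indep unfolding indep_vars_iff_distr_eq_PiM[of UNIV Y "\<lambda>_. borel", OF UNIV_not_empty Y] law by simp
  also have "\<dots> = distr (density (\<Pi>\<^sub>M k\<in>UNIV. lborel) (\<lambda>x. \<Prod>k\<in>UNIV. ?p (x k))) borel vec_lambda"
    by (subst PiM_density[OF finite_class.finite_UNIV sigma_finite_lborel _ sf]) simp_all
  also have "(\<lambda>x. \<Prod>k\<in>UNIV. ?p (x k)) = (\<lambda>x. ennreal (c ^ CARD('m) * exp (- (norm (vec_lambda x :: 'b^'m))\<^sup>2 / 2)))"
  proof
    fix x :: "'m \<Rightarrow> 'b"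
    have "(norm (vec_lambda x :: 'b^'m))\<^sup>2 = (\<Sum>k\<in>UNIV. (norm (x k))\<^sup>2)"
      by (simp add: norm_vec_def L2_set_def sum_nonneg)
    then show "(\<Prod>k\<in>UNIV. ?p (x k)) = ennreal (c ^ CARD('m) * exp (- (norm (vec_lambda x :: 'b^'m))\<^sup>2 / 2))"
      using \<open>0 \<le> c\<close> by (simp add: prod_ennreal prod.distrib exp_sum[symmetric] sum_negf sum_divide_distrib)
  qed
  also have "distr (density (\<Pi>\<^sub>M k\<in>UNIV. lborel) (\<lambda>x. ennreal (c ^ CARD('m) * exp (- (norm (vec_lambda x :: 'b^'m))\<^sup>2 / 2)))) borel vec_lambda
      = density (distr (\<Pi>\<^sub>M k\<in>UNIV. lborel) borel vec_lambda) (\<lambda>z :: 'b^'m. ennreal (c ^ CARD('m) * exp (- (norm z)\<^sup>2 / 2)))"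
    by (rule density_distr[symmetric]) measurable
  finally show "distr M borel (\<lambda>\<omega>. \<chi> k. Y k \<omega>)
      = density lborel (\<lambda>z. ennreal (c ^ CARD('m) * exp (- (norm z)\<^sup>2 / 2)))"
    unfolding distr_PiM_lborel .
  show "prob_space (distr M borel (\<lambda>\<omega>. \<chi> k. Y k \<omega>))"
    by (intro prob_space_distr vec_lambda_measurable Y)
qed (simp add: \<open>0 \<le> c\<close>)

section \<open>The tail bound\<close>

text \<open>The constant is what the Chebyshev estimate needs together with s exp (- s) >= 1/3. The
  proof shows sin (27/50) > 1/2 = sin (pi/6), hence pi < 81/25.\<close>

lemma pi_square_le: "pi\<^sup>2 \<le> 32 / 3"
proof -
  have "{..<4} = {0, 1, 2, 3 :: nat}" by auto
  \<comment> \<open>The cubic Taylor polynomial x - x^3 / 6 at x = 27/50; the error term below is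
    x^4 / 24.\<close>
  then have S: "(\<Sum>m<4. sin_coeff m * (27 / 50 :: real) ^ m) = 128439 / 250000"
    by (simp add: sin_coeff_def fact_numeral power_divide)
  have "\<bar>sin (27 / 50) - 128439 / 250000 :: real\<bar> \<le> 177147 / 50000000"
    using Maclaurin_sin_bound[of "27 / 50" 4] unfolding S by (simp add: fact_numeral power_divide)
  then have "sin (pi / 6) < sin (27 / 50)"
    unfolding sin_30 by (simp only: abs_le_iff) linarith
  then have "pi / 6 < 27 / 50"
    using sin_monotone_2pi_le[of "27 / 50" "pi / 6"] pi_gt_zero by linarith
  then have "pi\<^sup>2 \<le> (81 / 25)\<^sup>2"
    using pi_gt_zero by (intro power_mono) auto
  then show ?thesis by (simp add: power2_eq_square)
qed

(* The function s exp (-s) is increasing on [0,1]. *)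
lemma mult_exp_minus_ge:
  fixes s :: real
  assumes "ln 2 \<le> s" "s \<le> 1"
  shows "1 / 3 \<le> s * exp (- s)"
proof -
  \<comment> \<open>Expanded, this is the inequality needed for 1 + u <= exp u at u = ln 2 - s,
    which is sharp at the left endpoint.\<close>
  have "0 \<le> (s - ln 2) * (1 - s)"
    using assms by simp
  then have "ln 2 \<le> s * (1 + (ln 2 - s))"
    by (simp add: algebra_simps)
  also have "\<dots> \<le> s * exp (ln 2 - s)"
    using assms ln2_ge_two_thirds by (intro mult_left_mono exp_ge_add_one_self) auto
  also have "\<dots> = 2 * (s * exp (- s))"
    by (simp add: exp_diff exp_minus field_simps)
  finally show ?thesis using ln2_ge_two_thirds by linarith
qed

context std_gaussian_subgradient
begin

lemma tail_bound:
  assumes "0 < L" "0 < \<delta>" "\<delta> < 1"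
  shows "prob {x. sqrt 2 * \<delta> * L \<le> \<bar>f x - expectation f\<bar>} \<le> 2 * exp (- \<delta>\<^sup>2)"
proof (cases "ln 2 \<le> \<delta>\<^sup>2")
  case False
  then have "exp (- ln 2) \<le> exp (- \<delta>\<^sup>2)" by simp
  then have "1 \<le> 2 * exp (- \<delta>\<^sup>2)" by (simp add: exp_minus)
  then show ?thesis using prob_le_1 order_trans by blast
next
  case True
  have pos: "0 < \<delta>\<^sup>2" and le1: "\<delta>\<^sup>2 \<le> 1"
    using assms by (auto simp: power_le_one)
  have "prob {x. sqrt 2 * \<delta> * L \<le> \<bar>f x - expectation f\<bar>} \<le> variance f / (sqrt 2 * \<delta> * L)\<^sup>2"
    using Chebyshev_inequality[OF _ integrable_square, of "sqrt 2 * \<delta> * L"] assms by simp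
  also have "\<dots> \<le> (pi\<^sup>2 / 8 * L\<^sup>2) / (sqrt 2 * \<delta> * L)\<^sup>2"
    by (intro divide_right_mono variance_le) simp
  also have "\<dots> = pi\<^sup>2 / (16 * \<delta>\<^sup>2)"
    using assms by (simp add: power_mult_distrib)
  also have "\<dots> \<le> (32 / 3) / (16 * \<delta>\<^sup>2)"
    using pos by (intro divide_right_mono pi_square_le) simp
  \<comment> \<open>With s = \<delta>^2 this is 1/3 <= s exp (- s).\<close>
  also have "\<dots> \<le> 2 * exp (- \<delta>\<^sup>2)"
    using mult_exp_minus_ge[OF True le1] pos by (simp add: field_simps)
  finally show ?thesis .
qed

end

text \<open>A column at time \<open>tau k\<close> uses only noise at times below
  \<open>tau k\<close>, all of them below N, where \<open>noise_seq\<close> returns the original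
  values. Thus the random data matrix is a function of the finite Gaussian vector.\<close>

lemma data_matrix_noise_seq:
  assumes "bij_betw tau UNIV {..<N}"
  shows "data_matrix tau A (noise_seq tau (\<chi> k. w (tau k))) = data_matrix tau A w"
proof -
  have "lti_state A (noise_seq tau (\<chi> k. w (tau k))) (tau k) = lti_state A w (tau k)" for k
  proof (rule lti_state_cong)
    fix t assume "t < tau k"
    moreover have "tau k < N"
      using assms by (auto dest: bij_betwE)
    ultimately have "t \<in> range tau"
      using bij_betw_imp_surj_on[OF assms] by simp
    then show "noise_seq tau (\<chi> k. w (tau k)) t = w t"
      by (simp add: noise_seq_def f_inv_into_f)
  qed
  then show ?thesis by (simp add: data_matrix_def)
qed

text \<open>The integrability conjunct ensures that \<open>expectation\<close> is a genuine mean and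
  not the default value 0 of the integral.\<close>

theorem theorem22:
  fixes A :: "real^'n^'n" and M :: "'a measure" and w :: "nat \<Rightarrow> 'a \<Rightarrow> real^'n"
    and N :: nat and tau :: "'m::finite \<Rightarrow> nat" and L :: real
  assumes spectral: "spectral_radius A < 1"
    and columns: "bij_betw tau UNIV {..<N}"
    and prob: "prob_space M"
    and indep: "prob_space.indep_vars M (\<lambda>_. borel) w UNIV"
    and gaussian: "\<And>t. distributed M lborel (w t) (\<lambda>x. ennreal (std_gaussian_density x))"
    and L_pos: "L > 0"
    and L_bound: "\<And>v :: nat \<Rightarrow> real^'n.
      (\<Sum>i<N. \<Sum>j\<in>UNIV. \<bar>lti_state A v i \<bullet> axis j 1\<bar>\<^sup>2)
        \<le> L\<^sup>2 * (\<Sum>i<N. \<Sum>j\<in>UNIV. \<bar>v i \<bullet> axis j 1\<bar>\<^sup>2)"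
  shows "L-lipschitz_on UNIV (\<lambda>u :: (real^'n)^'m. sigma_max (data_matrix tau A (noise_seq tau u))) \<and>
      integrable M (\<lambda>\<omega>. sigma_max (data_matrix tau A (\<lambda>t. w t \<omega>))) \<and>
      (\<forall>\<delta>::real. 0 < \<delta> \<and> \<delta> < 1 \<longrightarrow>
      measure M {\<omega> \<in> space M.
        \<bar>sigma_max (data_matrix tau A (\<lambda>t. w t \<omega>))
           - prob_space.expectation M (\<lambda>\<omega>'. sigma_max (data_matrix tau A (\<lambda>t. w t \<omega>')))\<bar>
          \<ge> sqrt 2 * \<delta> * L}
        \<le> 2 * exp (- \<delta>\<^sup>2))"
proof -
  interpret prob_space M by (rule prob)
  define U where "U = (\<lambda>\<omega>. \<chi> k :: 'm. w (tau k) \<omega>)"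
  define F where "F = (\<lambda>u :: (real^'n)^'m. sigma_max (data_matrix tau A (noise_seq tau u)))"
  define c where "c = 1 / sqrt (2 * pi) ^ CARD('n)"
  have c_nonneg: "0 \<le> c" by (simp add: c_def)
  have "indep_vars (\<lambda>_. borel) (\<lambda>k. w (tau k)) UNIV"
    using indep_vars_reindex_inj[OF indep_vars_subset[OF indep] bij_betw_imp_inj_on[OF columns]] by simp
  moreover have "distributed M lborel (w (tau k)) (\<lambda>x. ennreal (c * exp (- (norm x)\<^sup>2 / 2)))" for k
    using gaussian[of "tau k"] by (simp add: std_gaussian_density_def c_def)
  ultimately have "std_gaussian (distr M borel U) (c ^ CARD('m))"
    unfolding U_def by (rule std_gaussian_vec[OF _ c_nonneg])
  \<comment> \<open>Linearity in the noise and the Frobenius bound by \<open>L\<close> supply the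
    subgradients of \<open>F\<close>.\<close>
  moreover have "std_gaussian_subgradient_axioms F L"
    unfolding F_def
    by (intro std_gaussian_subgradient_axioms.intro sigma_max_subgradient[OF linear_data_matrix]
        norm_data_matrix_le[OF columns less_imp_le[OF L_pos] L_bound])
  ultimately interpret G: std_gaussian_subgradient "distr M borel U" "c ^ CARD('m)" F L
    by (rule std_gaussian_subgradient.intro)
  have U [measurable]: "U \<in> borel_measurable M"
    unfolding U_def
    using distributed_measurable[OF gaussian] by (intro vec_lambda_measurable) simp
  have FU: "sigma_max (data_matrix tau A (\<lambda>t. w t \<omega>)) = F (U \<omega>)" for \<omega>
    unfolding F_def U_def data_matrix_noise_seq[OF columns, of A "\<lambda>t. w t \<omega>"] ..
  have E: "expectation (\<lambda>\<omega>. F (U \<omega>)) = G.expectation F"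
    by (simp add: integral_distr)
  have "measure M {\<omega> \<in> space M. sqrt 2 * \<delta> * L \<le> \<bar>F (U \<omega>) - expectation (\<lambda>\<omega>. F (U \<omega>))\<bar>} \<le> 2 * exp (- \<delta>\<^sup>2)"
    if "0 < \<delta>" "\<delta> < 1" for \<delta>
  proof -
    have "measure M {\<omega> \<in> space M. sqrt 2 * \<delta> * L \<le> \<bar>F (U \<omega>) - expectation (\<lambda>\<omega>. F (U \<omega>))\<bar>}
        = G.prob {u. sqrt 2 * \<delta> * L \<le> \<bar>F u - G.expectation F\<bar>}"
      unfolding E by (subst measure_distr) (auto intro!: arg_cong[where f = "measure M"])
    then show ?thesis
      using G.tail_bound[OF L_pos that] by simp
  qed
  moreover have "integrable M (\<lambda>\<omega>. F (U \<omega>))"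
    using G.integrable_f by (rule integrable_distr[OF U])
  ultimately show ?thesis
    unfolding FU using G.lipschitz by (simp add: F_def)
qed

end
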